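(* For all $0\leq\tau\leq 1$ and every positive integer $m$, consider the two optimization problems $$\min_{P,Q}\; d_{\rm TV}(P^m,Q^m)\quad\text{subject to } d_{\rm TV}(P,Q)=\tau,\qquad\qquad \max_{P,Q}\; d_{\rm TV}(P^m,Q^m)\quad\text{subject to } d_{\rm TV}(P,Q)=\tau,$$ where the minimization and maximization are over all probability measures $P$ and $Q$. Then the solution (optimal value) of the maximization is $1-(1-\tau)^m$, and the solution (optimal value) of the minimization is $$L(\tau,m)\;\triangleq\;\min_{0\leq\alpha\leq 1-\tau}\; d_{\rm TV}\big(P_{\rm inner}(\alpha)^m,\,Q_{\rm inner}(\alpha,\tau)^m\big),$$ where $P_{\rm inner}(\alpha)^m$ and $Q_{\rm inner}(\alpha,\tau)^m$ are the $m$-th order product distributions of binary random variables distributed as $$P_{\rm inner}(\alpha)=\begin{bmatrix}1-\alpha,&\alpha\end{bmatrix},\qquad Q_{\rm inner}(\alpha,\tau)=\begin{bmatrix}1-\alpha-\tau,&\alpha+\tau\end{bmatrix}.$$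
   Context: For probability measures $P,Q$ on a common measurable space $\mathcal{X}$, the total variation distance is $d_{\rm TV}(P,Q)=\sup_{S\subseteq\mathcal{X}}\{P(S)-Q(S)\}$, the supremum being over measurable sets $S$. $P^m$ denotes the $m$-fold product distribution of $P$ (the law of $m$ i.i.d. samples from $P$). The optimizations range over all pairs of probability measures $(P,Q)$ defined on a common measurable space; the space itself is not fixed. A row vector $[p_1,\ldots,p_k]$ with nonnegative entries summing to one denotes the probability mass function on the alphabet $\{1,\ldots,k\}$ assigning mass $p_i$ to $i$; two such vectors of the same length are viewed as distributions on the same alphabet. *)

theory Defs
  imports "HOL-Probability.Probability"
begin

text \<open>
  The supremum is over the common measurable sets, so this is used only for measures
  with \<open>sets P = sets Q\<close>.
\<close>
definition tv_dist :: "'a measure \<Rightarrow> 'a measure \<Rightarrow> real" where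
  "tv_dist P Q = (SUP S\<in>sets P. measure P S - measure Q S)"

definition iid :: "nat \<Rightarrow> 'a measure \<Rightarrow> (nat \<Rightarrow> 'a) measure" where
  "iid m P = (\<Pi>\<^sub>M i\<in>{..<m}. P)"

definition feasible :: "real \<Rightarrow> 'a measure \<Rightarrow> 'a measure \<Rightarrow> bool" where
  "feasible \<tau> P Q \<longleftrightarrow>
     prob_space P \<and> prob_space Q \<and> sets P = sets Q \<and> tv_dist P Q = \<tau>"

text \<open>The list \<open>[p\<^sub>1, \<dots>, p\<^sub>k]\<close> denotes the distribution on the alphabet \<open>{1, \<dots>, k}\<close>, equipped
  with all subsets, that gives mass \<open>p\<^sub>i\<close> to \<open>i\<close>; list indices start at 0.\<close>
definition row_dist :: "real list \<Rightarrow> nat measure" where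
  "row_dist ps = point_measure {1..length ps} (\<lambda>i. ennreal (ps ! (i - 1)))"

lemma prob_space_row_dist:
  assumes "\<And>p. p \<in> set ps \<Longrightarrow> 0 \<le> p" and "sum_list ps = 1"
  shows "prob_space (row_dist ps)"
proof (rule prob_spaceI)
  have "emeasure (row_dist ps) (space (row_dist ps)) = (\<Sum>i=1..length ps. ennreal (ps ! (i - 1)))"
    unfolding row_dist_def by (simp add: emeasure_point_measure_finite space_point_measure)
  also have "\<dots> = ennreal (\<Sum>i=1..length ps. ps ! (i - 1))"
    by (rule sum_ennreal) (use assms(1) in \<open>auto intro!: assms(1) nth_mem\<close>)
  also have "(\<Sum>i=1..length ps. ps ! (i - 1)) = (\<Sum>i=0..<length ps. ps ! i)"
    by (rule sum.reindex_bij_witness[of _ Suc "\<lambda>i. i - 1"]) auto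
  also have "\<dots> = 1"
    using assms(2) by (simp add: sum_list_sum_nth)
  finally show "emeasure (row_dist ps) (space (row_dist ps)) = 1" by simp
qed

definition P_inner :: "real \<Rightarrow> nat measure" where
  "P_inner \<alpha> = row_dist [1 - \<alpha>, \<alpha>]"

definition Q_inner :: "real \<Rightarrow> real \<Rightarrow> nat measure" where
  "Q_inner \<alpha> \<tau> = row_dist [1 - \<alpha> - \<tau>, \<alpha> + \<tau>]"

text \<open>The defining minimum is written as an infimum; that it is attained has to be
  stated separately.\<close>
definition L :: "real \<Rightarrow> nat \<Rightarrow> real" where
  "L \<tau> m = (INF \<alpha>\<in>{0..1 - \<tau>}. tv_dist (iid m (P_inner \<alpha>)) (iid m (Q_inner \<alpha> \<tau>)))"

end

theory Submission
  imports Defs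
begin

text \<open>
  A Hahn set \<open>A\<close> of the pair attains the total variation. For the minimum, the indicator of \<open>A\<close>
  pushes \<open>P, Q\<close> forward to \<open>P_inner \<alpha>, Q_inner \<alpha> \<tau>\<close> with \<open>\<alpha> = P(A)\<close>, and total variation does not
  increase under push-forward; the optimal \<open>\<alpha>\<close> exists because on a finite alphabet the total
  variation is a maximum of finitely many functions continuous in \<open>\<alpha>\<close>. For the maximum, the overlap
  \<open>min(P, Q)\<close> has mass \<open>1 - \<tau>\<close>, so \<open>c \<le> f + g\<close> implies \<open>c (1 - \<tau>) \<le> \<integral> f dP + \<integral> g dQ\<close>; iterating
  over the coordinates with \<open>f\<close> and \<open>g\<close> the indicators of the complement of \<open>S\<close> and of \<open>S\<close>
  bounds \<open>P\<^sup>m(S) - Q\<^sup>m(S)\<close>. Equality holds at \<open>\<alpha> = 0\<close>, as the all-ones word shows.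
\<close>

section \<open>Total variation as a supremum and its Hahn set\<close>

lemma bdd_above_tv_dist:
  assumes "prob_space P" "prob_space Q"
  shows "bdd_above ((\<lambda>S. measure P S - measure Q S) ` sets P)"
proof (rule bdd_aboveI2)
  fix S
  show "measure P S - measure Q S \<le> 1"
    using prob_space.prob_le_1[OF assms(1), of S] measure_nonneg[of Q S] by linarith
qed

lemma tv_dist_ge:
  assumes "prob_space P" "prob_space Q" "S \<in> sets P"
  shows "measure P S - measure Q S \<le> tv_dist P Q"
  unfolding tv_dist_def by (rule cSUP_upper[OF assms(3) bdd_above_tv_dist[OF assms(1,2)]])

lemma tv_dist_le:
  assumes "\<And>S. S \<in> sets P \<Longrightarrow> measure P S - measure Q S \<le> c"
  shows "tv_dist P Q \<le> c"
  unfolding tv_dist_def using assms by (intro cSUP_least) auto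

text \<open>The supremum is reached at the complement of \<open>A\<close>. The set \<open>A\<close>
  is taken on the side where \<open>Q\<close> dominates, so that later \<open>P(A)\<close> and
  \<open>Q(A)\<close> are the masses of the letter 2.\<close>

lemma tv_dist_Hahn:
  assumes P: "prob_space P" and Q: "prob_space Q" and s: "sets P = sets Q"
  obtains A where "A \<in> sets P" "tv_dist P Q = measure Q A - measure P A"
    "\<forall>X\<in>sets P. X \<subseteq> A \<longrightarrow> emeasure P X \<le> emeasure Q X"
    "\<forall>X\<in>sets P. X \<inter> A = {} \<longrightarrow> emeasure Q X \<le> emeasure P X"
proof -
  interpret P: prob_space P by fact
  interpret Q: prob_space Q by fact
  have sp: "space P = space Q" using s by (rule sets_eq_imp_space_eq)
  obtain A where A: "A \<in> sets Q"
    and le': "\<forall>X\<in>sets Q. X \<subseteq> A \<longrightarrow> emeasure P X \<le> emeasure Q X"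
    and ge': "\<forall>X\<in>sets Q. X \<inter> A = {} \<longrightarrow> emeasure Q X \<le> emeasure P X"
    using finite_unsigned_Hahn_decomposition[OF Q.finite_measure_axioms P.finite_measure_axioms s]
    by (elim bexE conjE)
  note le = le'[rule_format] and ge = ge'[rule_format]
  have A': "A \<in> sets P" using A s by simp
  have "tv_dist P Q = measure Q A - measure P A"
  proof (rule antisym)
    show "tv_dist P Q \<le> measure Q A - measure P A"
    proof (rule tv_dist_le)
      fix S assume S: "S \<in> sets P"
      then have S': "S \<in> sets Q" using s by simp
      \<comment> \<open>The part of \<open>S\<close> inside \<open>A\<close> contributes at most 0
        to \<open>P(S) - Q(S)\<close>. For the part outside \<open>A\<close>, comparing the masses
        of what \<open>S\<close> leaves uncovered there gives the bound
        \<open>Q(A) - P(A)\<close>.\<close>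
      have "measure P (S \<inter> A) \<le> measure Q (S \<inter> A)"
        using le[of "S \<inter> A"] S' A by (simp add: P.emeasure_eq_measure Q.emeasure_eq_measure)
      moreover have "measure Q (space Q - S - A) \<le> measure P (space Q - S - A)"
        using ge[of "space Q - S - A"] S' A
        by (simp add: P.emeasure_eq_measure Q.emeasure_eq_measure Diff_Int_distrib2)
      moreover have "measure P S = measure P (S \<inter> A) + measure P (S - A)"
        using S A' P.finite_measure_Diff'[of S A] by simp
      moreover have "measure Q S = measure Q (S \<inter> A) + measure Q (S - A)"
        using S' A Q.finite_measure_Diff'[of S A] by simp
      moreover have "measure M (space M - S - A) = 1 - measure M A - measure M (S - A)"
        if "prob_space M" "S \<in> sets M" "A \<in> sets M" for M
      proof -
        interpret prob_space M by fact
        have "space M - S - A = space M - (A \<union> (S - A))" by blast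
        then show ?thesis
          using that prob_compl[of "A \<union> (S - A)"] finite_measure_Union[of A "S - A"]
          by (simp add: sets.Un sets.Diff del: Un_Diff_cancel)
      qed
      from this[OF P S A'] this[OF Q S' A]
      have "measure P (space Q - S - A) = 1 - measure P A - measure P (S - A)"
        "measure Q (space Q - S - A) = 1 - measure Q A - measure Q (S - A)"
        by (simp_all only: sp)
      ultimately show "measure P S - measure Q S \<le> measure Q A - measure P A" by linarith
    qed
    \<comment> \<open>The witness is the complement of \<open>A\<close>; both total masses are 1, so
      the difference changes sign.\<close>
    show "measure Q A - measure P A \<le> tv_dist P Q"
      using tv_dist_ge[OF P Q sets.compl_sets[OF A']] A A' P.prob_compl[of A] Q.prob_compl[of A]
      by (simp add: sp)
  qed
  with A' show thesis by (rule that) (simp_all add: s le' ge')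
qed

section \<open>Push-forwards and product measures\<close>

text \<open>Every event of \<open>N\<close> pulls back to an event of \<open>P\<close>, so the left
  supremum takes only values that also occur on the right.\<close>

lemma tv_dist_distr_le:
  assumes P: "prob_space P" and Q: "prob_space Q" and s: "sets P = sets Q"
    and f [measurable]: "f \<in> measurable P N"
  shows "tv_dist (distr P N f) (distr Q N f) \<le> tv_dist P Q"
proof (rule tv_dist_le)
  have f': "f \<in> measurable Q N" using f s by (simp cong: measurable_cong_sets)
  have sp: "space P = space Q" using s by (rule sets_eq_imp_space_eq)
  fix S assume "S \<in> sets (distr P N f)"
  then show "measure (distr P N f) S - measure (distr Q N f) S \<le> tv_dist P Q"
    using tv_dist_ge[OF P Q measurable_sets[OF f], of S] f f'
    by (simp add: measure_distr sp)
qed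

lemma sets_iid_cong: "sets P = sets Q \<Longrightarrow> sets (iid m P) = sets (iid m Q)"
  unfolding iid_def by (intro sets_PiM_cong) auto

lemma prob_space_iid: "prob_space P \<Longrightarrow> prob_space (iid m P)"
  unfolding iid_def by (intro prob_space_PiM)

lemma iid_distr:
  assumes "prob_space P" "prob_space N" "f \<in> measurable P N"
  shows "iid m (distr P N f) = distr (iid m P) (iid m N) (compose {..<m} f)"
  unfolding iid_def using assms by (intro distr_PiM_finite_prob_space'[symmetric]) auto

lemma measurable_compose_iid:
  assumes [measurable]: "f \<in> measurable P N"
  shows "compose {..<m} f \<in> measurable (iid m P) (iid m N)"
  unfolding iid_def compose_def by measurable

text \<open>Applying \<open>f\<close> to each coordinate commutes with forming products, which
  reduces this to the push-forward bound for a single map.\<close>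

lemma tv_dist_iid_distr_le:
  assumes "prob_space P" "prob_space Q" "prob_space N" "sets P = sets Q"
    and f: "f \<in> measurable P N"
  shows "tv_dist (iid m (distr P N f)) (iid m (distr Q N f)) \<le> tv_dist (iid m P) (iid m Q)"
proof -
  have "f \<in> measurable Q N" using f assms(4) by (simp cong: measurable_cong_sets)
  then have "iid m (distr P N f) = distr (iid m P) (iid m N) (compose {..<m} f)"
    "iid m (distr Q N f) = distr (iid m Q) (iid m N) (compose {..<m} f)"
    using assms by (simp_all only: iid_distr)
  then show ?thesis
    using tv_dist_distr_le[OF prob_space_iid[OF assms(1)] prob_space_iid[OF assms(2)]
        sets_iid_cong[OF assms(4)] measurable_compose_iid[OF f], of m] by simp
qed

section \<open>The overlap of two measures and the upper bound for products\<close>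

text \<open>Domination is known only inside \<open>C\<close>. Passing to the densities
  \<open>indicator C\<close> turns it into the order on whole measures, for which integration is
  monotone.\<close>

lemma set_nn_integral_mono_measure:
  assumes MN: "sets M = sets N" and C: "C \<in> sets M" and h: "h \<in> borel_measurable M"
    and le: "\<And>X. X \<in> sets M \<Longrightarrow> X \<subseteq> C \<Longrightarrow> emeasure M X \<le> emeasure N X"
  shows "set_nn_integral M C h \<le> set_nn_integral N C h"
proof -
  have C': "C \<in> sets N" using C MN by simp
  have h': "h \<in> borel_measurable N" using h MN by (simp cong: measurable_cong_sets)
  have dens: "emeasure (density K (indicator C)) X = emeasure K (C \<inter> X)"
    if "C \<in> sets K" "X \<in> sets K" for K :: "'a measure" and X
  proof -
    have "emeasure (density K (indicator C)) X = (\<integral>\<^sup>+x. indicator (C \<inter> X) x \<partial>K)"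
      using that by (simp add: emeasure_density indicator_inter_arith)
    then show ?thesis using that by simp
  qed
  have "density M (indicator C) \<le> density N (indicator C)"
  proof (subst le_measure)
    show "sets (density M (indicator C)) = sets (density N (indicator C))" using MN by simp
    show "\<forall>X\<in>sets (density M (indicator C)).
        emeasure (density M (indicator C)) X \<le> emeasure (density N (indicator C)) X"
    proof
      fix X assume "X \<in> sets (density M (indicator C))"
      then have X: "X \<in> sets M" "X \<in> sets N" using MN by auto
      then show "emeasure (density M (indicator C)) X \<le> emeasure (density N (indicator C)) X"
        using le[of "C \<inter> X"] C C' by (simp add: dens sets.Int)
    qed
  qed
  then have "nn_integral (density M (indicator C)) h \<le> nn_integral (density N (indicator C)) h"
    by (intro nn_integral_mono_measure) (simp_all add: MN)
  then show ?thesis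
    using nn_integral_density[of "indicator C" M h] nn_integral_density[of "indicator C" N h]
      C C' h h' by (simp add: mult.commute)
qed

text \<open>This integrates \<open>c \<le> f + g\<close> against \<open>min(P, Q)\<close>, which is
  \<open>P\<close> on \<open>A\<close> and \<open>Q\<close> on its complement \<open>B\<close>; the
  minimum itself is never formed as a measure.\<close>

lemma overlap_integral_le:
  assumes P: "prob_space P" and Q: "prob_space Q" and s: "sets P = sets Q"
    and f [measurable]: "f \<in> borel_measurable P" and g [measurable]: "g \<in> borel_measurable P"
    and c: "\<And>x. x \<in> space P \<Longrightarrow> c \<le> f x + g x"
  shows "c * ennreal (1 - tv_dist P Q) \<le> (\<integral>\<^sup>+x. f x \<partial>P) + (\<integral>\<^sup>+x. g x \<partial>Q)"
proof -
  interpret P: prob_space P by fact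
  interpret Q: prob_space Q by fact
  note [measurable_cong] = s[symmetric]
  have sp: "space P = space Q" using s by (rule sets_eq_imp_space_eq)
  obtain A where A [measurable]: "A \<in> sets P" and tv: "tv_dist P Q = measure Q A - measure P A"
    and le': "\<forall>X\<in>sets P. X \<subseteq> A \<longrightarrow> emeasure P X \<le> emeasure Q X"
    and ge': "\<forall>X\<in>sets P. X \<inter> A = {} \<longrightarrow> emeasure Q X \<le> emeasure P X"
    by (rule tv_dist_Hahn[OF P Q s])
  note le = le'[rule_format] and ge = ge'[rule_format]
  define B where "B = space P - A"
  have B [measurable]: "B \<in> sets P" unfolding B_def by measurable
  have A' [measurable]: "A \<in> sets Q" and B' [measurable]: "B \<in> sets Q" using A B s by auto
  have split: "(\<integral>\<^sup>+x. h x \<partial>M) = set_nn_integral M A h + set_nn_integral M B h"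
    if "sets M = sets P" "h \<in> borel_measurable P" for M and h :: "'a \<Rightarrow> ennreal"
  proof -
    note [measurable_cong] = that(1)
    note that(2) [measurable]
    have spM: "space M = space P" using that(1) by (rule sets_eq_imp_space_eq)
    have "(\<integral>\<^sup>+x. h x \<partial>M) = (\<integral>\<^sup>+x. h x * indicator A x + h x * indicator B x \<partial>M)"
      by (intro nn_integral_cong) (auto simp: B_def spM split: split_indicator)
    then show ?thesis by (simp add: nn_integral_add)
  qed
  have "1 - tv_dist P Q = measure P A + measure Q B"
    using Q.prob_compl[OF A'] by (simp add: tv B_def sp)
  then have "c * ennreal (1 - tv_dist P Q) = c * (emeasure P A + emeasure Q B)"
    by (simp add: P.emeasure_eq_measure Q.emeasure_eq_measure)
  also have "\<dots> = set_nn_integral P A (\<lambda>_. c) + set_nn_integral Q B (\<lambda>_. c)"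
    by (simp add: nn_integral_cmult_indicator distrib_left)
  also have "\<dots> \<le> set_nn_integral P A (\<lambda>x. f x + g x) + set_nn_integral Q B (\<lambda>x. f x + g x)"
    by (intro add_mono nn_integral_mono mult_right_mono) (auto simp: c sp[symmetric])
  also have "\<dots> = (set_nn_integral P A f + set_nn_integral P A g)
      + (set_nn_integral Q B f + set_nn_integral Q B g)"
    by (simp add: distrib_right nn_integral_add)
  \<comment> \<open>Only two of the four terms change: \<open>g\<close> on \<open>A\<close> moves
    from \<open>P\<close> to the larger \<open>Q\<close>, and \<open>f\<close> on \<open>B\<close>
    moves from \<open>Q\<close> to the larger \<open>P\<close>.\<close>
  also have "\<dots> \<le> (set_nn_integral P A f + set_nn_integral Q A g)
      + (set_nn_integral P B f + set_nn_integral Q B g)"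
    by (intro add_mono order.refl set_nn_integral_mono_measure)
      (auto simp: B_def s intro!: le ge)
  also have "\<dots> = (\<integral>\<^sup>+x. f x \<partial>P) + (\<integral>\<^sup>+x. g x \<partial>Q)"
    using split[OF refl f] split[OF s[symmetric] g] by (simp only: ac_simps)
  finally show ?thesis .
qed

text \<open>Induction on \<open>m\<close>, integrating out one coordinate at a time. Each
  integration costs a factor \<open>1 - tv_dist P Q\<close>, which is absorbed into the constant;
  this is why \<open>c\<close>, \<open>f\<close> and \<open>g\<close> are arbitrary.\<close>

lemma overlap_integral_iid_le:
  assumes P: "prob_space P" and Q: "prob_space Q" and s: "sets P = sets Q"
    and "f \<in> borel_measurable (iid m P)" "g \<in> borel_measurable (iid m P)"
    and "\<And>x. x \<in> space (iid m P) \<Longrightarrow> c \<le> f x + g x"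
  shows "c * ennreal (1 - tv_dist P Q) ^ m \<le> (\<integral>\<^sup>+x. f x \<partial>iid m P) + (\<integral>\<^sup>+x. g x \<partial>iid m Q)"
proof -
  interpret P: product_sigma_finite "\<lambda>_::nat. P"
    using P by (simp add: product_sigma_finite_def prob_space_imp_sigma_finite)
  interpret Q: product_sigma_finite "\<lambda>_::nat. Q"
    using Q by (simp add: product_sigma_finite_def prob_space_imp_sigma_finite)
  show ?thesis using assms(4-6)
  proof (induction m arbitrary: f g c)
    \<comment> \<open>The empty product has a single point, and the claim is the pointwise
      hypothesis there.\<close>
    case 0
    then show ?case
      by (simp add: iid_def P.nn_integral_empty Q.nn_integral_empty space_PiM)
  next
    case (Suc m)
    \<comment> \<open>Coordinates are numbered from 0, so \<open>m\<close> is the new one.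
      \<open>?F\<close> integrates it out.\<close>
    let ?F = "\<lambda>M f x. \<integral>\<^sup>+y. f (x(m := y)) \<partial>M"
    have ins: "{..<Suc m} = insert m {..<m}" by auto
    have f [measurable]: "f \<in> borel_measurable (Pi\<^sub>M (insert m {..<m}) (\<lambda>_. P))"
      and g [measurable]: "g \<in> borel_measurable (Pi\<^sub>M (insert m {..<m}) (\<lambda>_. P))"
      using Suc.prems(1,2) by (simp_all add: iid_def ins)
    note [measurable_cong] = s[symmetric]
    have g' [measurable]: "g \<in> borel_measurable (Pi\<^sub>M (insert m {..<m}) (\<lambda>_. Q))"
      using g sets_iid_cong[OF s, of "Suc m"] by (simp add: iid_def ins cong: measurable_cong_sets)
    have "c * ennreal (1 - tv_dist P Q) ^ Suc m = c * ennreal (1 - tv_dist P Q) * ennreal (1 - tv_dist P Q) ^ m"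
      by (simp add: ac_simps)
    also have "\<dots> \<le> (\<integral>\<^sup>+x. ?F P f x \<partial>iid m P) + (\<integral>\<^sup>+x. ?F Q g x \<partial>iid m Q)"
    proof (rule Suc.IH)
      show "?F P f \<in> borel_measurable (iid m P)"
        unfolding iid_def by (rule P.borel_measurable_nn_integral) measurable
      show "?F Q g \<in> borel_measurable (iid m P)"
        unfolding iid_def by (rule Q.borel_measurable_nn_integral) measurable
      fix x assume x: "x \<in> space (iid m P)"
      have upd [measurable]: "(\<lambda>y. x(m := y)) \<in> measurable P (Pi\<^sub>M (insert m {..<m}) (\<lambda>_. P))"
        using x unfolding iid_def by (intro measurable_fun_upd[where J="{..<m}"]) auto
      \<comment> \<open>With the first \<open>m\<close> coordinates frozen at \<open>x\<close>, this
        is the one-coordinate overlap bound.\<close>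
      show "c * ennreal (1 - tv_dist P Q) \<le> ?F P f x + ?F Q g x"
      proof (rule overlap_integral_le[OF P Q s])
        fix y assume "y \<in> space P"
        then have "x(m := y) \<in> space (iid (Suc m) P)"
          using measurable_space[OF upd] by (simp add: iid_def ins)
        then show "c \<le> f (x(m := y)) + g (x(m := y))" by (rule Suc.prems(3))
      qed measurable
    qed
    also have "\<dots> = (\<integral>\<^sup>+x. f x \<partial>iid (Suc m) P) + (\<integral>\<^sup>+x. g x \<partial>iid (Suc m) Q)"
      by (simp add: iid_def ins P.product_nn_integral_insert Q.product_nn_integral_insert)
    finally show ?case .
  qed
qed

text \<open>The indicators of \<open>S\<close> and of its complement add up to 1, so the overlap
  bound applies with \<open>c = 1\<close>.\<close>

lemma tv_dist_iid_le:
  assumes P: "prob_space P" and Q: "prob_space Q" and s: "sets P = sets Q"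
  shows "tv_dist (iid m P) (iid m Q) \<le> 1 - (1 - tv_dist P Q) ^ m"
proof (rule tv_dist_le)
  interpret P: prob_space "iid m P" using P by (rule prob_space_iid)
  interpret Q: prob_space "iid m Q" using Q by (rule prob_space_iid)
  \<comment> \<open>As \<open>ennreal\<close> sends negative numbers to 0, the sign of
    \<open>1 - tv_dist P Q\<close> is needed to return to the reals.\<close>
  have tv1: "tv_dist P Q \<le> 1"
    using prob_space.prob_le_1[OF P] measure_nonneg[of Q]
    by (intro tv_dist_le) (smt (verit))
  note s' = sets_iid_cong[OF s, of m]
  have sp: "space (iid m P) = space (iid m Q)" using s' by (rule sets_eq_imp_space_eq)
  fix S assume S [measurable]: "S \<in> sets (iid m P)"
  let ?T = "space (iid m P) - S"
  have T [measurable]: "?T \<in> sets (iid m P)" by measurable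
  have "1 * ennreal (1 - tv_dist P Q) ^ m
      \<le> (\<integral>\<^sup>+x. indicator ?T x \<partial>iid m P) + (\<integral>\<^sup>+x. indicator S x \<partial>iid m Q)"
    by (intro overlap_integral_iid_le[OF P Q s]) (auto split: split_indicator)
  also have "\<dots> = ennreal (measure (iid m P) ?T + measure (iid m Q) S)"
    using S T s' by (simp add: P.emeasure_eq_measure Q.emeasure_eq_measure)
  finally have "(1 - tv_dist P Q) ^ m \<le> measure (iid m P) ?T + measure (iid m Q) S"
    using tv1 by (simp add: ennreal_power flip: ennreal_plus)
  then show "measure (iid m P) S - measure (iid m Q) S \<le> 1 - (1 - tv_dist P Q) ^ m"
    using P.prob_compl[OF S] by simp
qed

section \<open>The binary pairs\<close>

lemma sets_row_dist: "sets (row_dist ps) = Pow {1..length ps}"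
  by (simp add: row_dist_def sets_point_measure)

lemma sets_inner [simp]: "sets (P_inner \<alpha>) = Pow {1, 2}" "sets (Q_inner \<alpha> \<tau>) = Pow {1, 2}"
  by (auto simp: P_inner_def Q_inner_def sets_row_dist)

lemma space_inner [simp]: "space (P_inner \<alpha>) = {1, 2}" "space (Q_inner \<alpha> \<tau>) = {1, 2}"
  by (auto simp: P_inner_def Q_inner_def row_dist_def space_point_measure)

lemma emeasure_inner [simp]:
  "emeasure (P_inner \<alpha>) {Suc 0} = ennreal (1 - \<alpha>)" "emeasure (P_inner \<alpha>) {2} = ennreal \<alpha>"
  "emeasure (Q_inner \<alpha> \<tau>) {Suc 0} = ennreal (1 - \<alpha> - \<tau>)" "emeasure (Q_inner \<alpha> \<tau>) {2} = ennreal (\<alpha> + \<tau>)"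
  by (simp_all add: P_inner_def Q_inner_def row_dist_def emeasure_point_measure_finite)

lemma prob_space_P_inner: "\<alpha> \<in> {0..1} \<Longrightarrow> prob_space (P_inner \<alpha>)"
  unfolding P_inner_def by (rule prob_space_row_dist) auto

text \<open>Both distributions belong to one family indexed by the mass of the letter 2, so facts
  about \<open>P_inner\<close> cover \<open>Q_inner\<close> as well.\<close>

lemma Q_inner_eq_P_inner: "Q_inner \<alpha> \<tau> = P_inner (\<alpha> + \<tau>)"
  by (simp add: P_inner_def Q_inner_def diff_diff_eq)

lemma tv_dist_inner:
  assumes "0 \<le> \<tau>" "\<alpha> \<in> {0..1 - \<tau>}"
  shows "tv_dist (P_inner \<alpha>) (Q_inner \<alpha> \<tau>) = \<tau>"
proof -
  have P: "prob_space (P_inner \<alpha>)" and Q: "prob_space (Q_inner \<alpha> \<tau>)"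
    using assms by (auto simp: Q_inner_eq_P_inner intro!: prob_space_P_inner)
  have full: "measure (P_inner \<alpha>) {Suc 0, 2} = 1" "measure (Q_inner \<alpha> \<tau>) {Suc 0, 2} = 1"
    using prob_space.prob_space[OF P] prob_space.prob_space[OF Q] by simp_all
  show ?thesis
  proof (rule antisym)
    show "tv_dist (P_inner \<alpha>) (Q_inner \<alpha> \<tau>) \<le> \<tau>"
    proof (rule tv_dist_le)
      fix S assume "S \<in> sets (P_inner \<alpha>)"
      \<comment> \<open>The four differences are 0, \<open>\<tau>\<close>, \<open>-\<tau>\<close>
        and 0.\<close>
      then have "S = {} \<or> S = {Suc 0} \<or> S = {2} \<or> S = {Suc 0, 2}" by auto
      then show "measure (P_inner \<alpha>) S - measure (Q_inner \<alpha> \<tau>) S \<le> \<tau>"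
        using assms full by (auto simp: measure_def simp del: ennreal_plus)
    qed
    show "\<tau> \<le> tv_dist (P_inner \<alpha>) (Q_inner \<alpha> \<tau>)"
      using tv_dist_ge[OF P Q, of "{Suc 0}"] assms by (simp add: measure_def)
  qed
qed

lemma feasible_inner:
  assumes "0 \<le> \<tau>" "\<alpha> \<in> {0..1 - \<tau>}"
  shows "feasible \<tau> (P_inner \<alpha>) (Q_inner \<alpha> \<tau>)"
  using assms by (auto simp: feasible_def tv_dist_inner Q_inner_eq_P_inner intro!: prob_space_P_inner)
    (simp add: tv_dist_inner flip: Q_inner_eq_P_inner)

text \<open>The letter 2 codes membership in \<open>A\<close>. The target \<open>P_inner 0\<close>
  supplies the power set of \<open>{1, 2}\<close> as sigma-algebra.\<close>

lemma distr_indicator_eq_P_inner: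
  assumes P: "prob_space P" and A [measurable]: "A \<in> sets P"
  shows "distr P (P_inner 0) (\<lambda>x. if x \<in> A then 2 else 1) = P_inner (measure P A)"
proof (rule measure_eqI_finite[where A="{1, 2}"])
  interpret P: prob_space P by fact
  have m: "(\<lambda>x. if x \<in> A then 2 else 1) \<in> measurable P (P_inner 0)"
    by (rule measurable_If_set) auto
  have pre: "(\<lambda>x. if x \<in> A then 2 else 1) -` {Suc 0} \<inter> space P = space P - A"
    "(\<lambda>x. if x \<in> A then 2 else 1) -` {2::nat} \<inter> space P = A"
    using sets.sets_into_space[OF A] by (auto split: if_splits)
  fix a :: nat assume "a \<in> {1, 2}"
  then show "emeasure (distr P (P_inner 0) (\<lambda>x. if x \<in> A then 2 else 1)) {a}
      = emeasure (P_inner (measure P A)) {a}"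
    using m pre P.prob_compl[OF A] by (auto simp: emeasure_distr P.emeasure_eq_measure)
qed auto

text \<open>Since \<open>Q(A) = P(A) + \<tau>\<close>, a single map sends \<open>P\<close> and
  \<open>Q\<close> to an inner pair, and \<open>Q(A) \<le> 1\<close> puts \<open>P(A)\<close> in the
  admissible range.\<close>

lemma tv_dist_iid_ge_inner:
  assumes "feasible \<tau> P Q"
  obtains \<alpha> where "\<alpha> \<in> {0..1 - \<tau>}"
    "tv_dist (iid m (P_inner \<alpha>)) (iid m (Q_inner \<alpha> \<tau>)) \<le> tv_dist (iid m P) (iid m Q)"
proof -
  have P: "prob_space P" and Q: "prob_space Q" and s: "sets P = sets Q" and tv: "tv_dist P Q = \<tau>"
    using assms by (auto simp: feasible_def)
  obtain A where A: "A \<in> sets P" and eq: "tv_dist P Q = measure Q A - measure P A"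
    by (rule tv_dist_Hahn[OF P Q s])
  let ?f = "\<lambda>x. if x \<in> A then 2 else 1 :: nat"
  have "?f \<in> measurable P (P_inner 0)"
    using A by (intro measurable_If_set) auto
  from tv_dist_iid_distr_le[OF P Q prob_space_P_inner s this, of m]
  have "tv_dist (iid m (P_inner (measure P A))) (iid m (Q_inner (measure P A) \<tau>))
      \<le> tv_dist (iid m P) (iid m Q)"
    using P Q A s eq tv by (simp add: distr_indicator_eq_P_inner Q_inner_eq_P_inner)
  moreover have "measure P A \<in> {0..1 - \<tau>}"
    using prob_space.prob_le_1[OF Q, of A] eq tv by simp
  ultimately show thesis by (rule that[rotated])
qed

text \<open>The event \<open>?S\<close> holds just the all-ones word, which has probability 1 for
  parameter 0 and \<open>(1 - \<tau>) ^ m\<close> for parameter \<open>\<tau>\<close>.\<close>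

lemma tv_dist_iid_inner_0:
  assumes \<tau>: "\<tau> \<in> {0..1}"
  shows "1 - (1 - \<tau>) ^ m \<le> tv_dist (iid m (P_inner 0)) (iid m (Q_inner 0 \<tau>))"
proof -
  have prob: "prob_space (P_inner t)" if "t \<in> {0..1}" for t
    using that by (rule prob_space_P_inner)
  let ?S = "Pi\<^sub>E {..<m} (\<lambda>_. {1::nat})"
  have S: "measure (iid m (P_inner t)) ?S = (1 - t) ^ m" if t: "t \<in> {0..1}" for t
  proof -
    interpret product_sigma_finite "\<lambda>_::nat. P_inner t"
      using prob[OF t] by (simp add: product_sigma_finite_def prob_space_imp_sigma_finite)
    have "emeasure (iid m (P_inner t)) ?S = ennreal (1 - t) ^ m"
      unfolding iid_def by (subst emeasure_PiM) auto
    then show ?thesis using t by (simp add: measure_def ennreal_power)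
  qed
  have "?S \<in> sets (iid m (P_inner 0))"
    unfolding iid_def by (rule sets_PiM_I_finite) auto
  then show ?thesis
    using tv_dist_ge[of "iid m (P_inner 0)" "iid m (P_inner \<tau>)" ?S] \<tau> S[of 0] S[of \<tau>]
    by (simp add: Q_inner_eq_P_inner prob_space_iid prob)
qed

section \<open>Continuity in the parameter and attainment of the minimum\<close>

text \<open>The probability of an event is a polynomial in the parameter, a sum over its finitely
  many words. The parameter \<open>\<beta>\<close> only names the sigma-algebra, which is the same
  for all parameters.\<close>

lemma continuous_on_measure_iid_P_inner:
  assumes S: "S \<in> sets (iid m (P_inner \<beta>))"
  shows "continuous_on {0..1} (\<lambda>\<alpha>. measure (iid m (P_inner \<alpha>)) S)"
proof -
  have sub: "S \<subseteq> Pi\<^sub>E {..<m} (\<lambda>_. {1, 2})"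
    using sets.sets_into_space[OF S] by (simp add: iid_def space_PiM)
  then have fin: "finite S" by (rule finite_subset) (auto intro!: finite_PiE)
  have "measure (iid m (P_inner \<alpha>)) S = (\<Sum>x\<in>S. \<Prod>i<m. if x i = 1 then 1 - \<alpha> else \<alpha>)"
    if \<alpha>: "\<alpha> \<in> {0..1}" for \<alpha>
  proof -
    interpret P: prob_space "P_inner \<alpha>" using \<alpha> by (rule prob_space_P_inner)
    interpret product_sigma_finite "\<lambda>_::nat. P_inner \<alpha>"
      by (simp add: product_sigma_finite_def P.prob_space_axioms prob_space_imp_sigma_finite)
    interpret iid: prob_space "iid m (P_inner \<alpha>)"
      using P.prob_space_axioms by (rule prob_space_iid)
    have vals: "x i = 1 \<or> x i = 2" if "x \<in> S" "i < m" for x i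
      using PiE_mem[OF subsetD[OF sub that(1)], of i] that(2) by auto
    \<comment> \<open>Writing a word as a box makes the product formula applicable.\<close>
    have single: "{x} = Pi\<^sub>E {..<m} (\<lambda>i. {x i})" if "x \<in> S" for x
      using that sub by (subst PiE_singleton) (auto simp: PiE_def)
    have meas: "{x} \<in> sets (iid m (P_inner \<alpha>))" if "x \<in> S" for x
      unfolding single[OF that] iid_def using vals[OF that] by (intro sets_PiM_I_finite) auto
    have "measure (iid m (P_inner \<alpha>)) {x} = (\<Prod>i<m. if x i = 1 then 1 - \<alpha> else \<alpha>)" if x: "x \<in> S" for x
    proof -
      have "emeasure (iid m (P_inner \<alpha>)) {x} = (\<Prod>i<m. emeasure (P_inner \<alpha>) {x i})"
        unfolding iid_def using vals[OF x] by (subst single[OF x], subst emeasure_PiM) auto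
      also have "\<dots> = (\<Prod>i<m. ennreal (if x i = 1 then 1 - \<alpha> else \<alpha>))"
        using vals[OF x] by (intro prod.cong) force+
      also have "\<dots> = ennreal (\<Prod>i<m. if x i = 1 then 1 - \<alpha> else \<alpha>)"
        using \<alpha> by (intro prod_ennreal) auto
      finally show ?thesis using \<alpha> by (simp add: measure_def prod_nonneg)
    qed
    then show ?thesis
      using iid.finite_measure_eq_sum_singleton[OF fin] meas by simp
  qed
  moreover have "continuous_on {0..1} (\<lambda>\<alpha>::real. if x i = 1 then 1 - \<alpha> else \<alpha>)"
    for x :: "nat \<Rightarrow> nat" and i
    by (cases "x i = 1") (auto intro!: continuous_intros)
  then have "continuous_on {0..1} (\<lambda>\<alpha>::real. \<Sum>x\<in>S. \<Prod>i<m. if x i = 1 then 1 - \<alpha> else \<alpha>)"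
    by (intro continuous_on_sum continuous_on_prod)
  ultimately show ?thesis by (subst continuous_on_cong[OF refl])
qed

lemma continuous_on_SUP_finite:
  fixes f :: "'i \<Rightarrow> 'a::topological_space \<Rightarrow> real"
  assumes "finite I" "I \<noteq> {}" "\<And>i. i \<in> I \<Longrightarrow> continuous_on A (f i)"
  shows "continuous_on A (\<lambda>x. SUP i\<in>I. f i x)"
  using assms
proof (induction I rule: finite_ne_induct)
  case (insert i I)
  have "(SUP j\<in>insert i I. f j x) = max (f i x) (SUP j\<in>I. f j x)" for x
    using insert.hyps by (simp add: cSup_insert sup_max)
  with insert show ?case by (auto intro!: continuous_on_max)
qed simp

text \<open>The supremum runs over one finite family of events, independent of
  \<open>\<alpha>\<close>, so it is a finite maximum of continuous functions.\<close>

lemma continuous_on_tv_dist_iid_inner: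
  assumes "0 \<le> \<tau>"
  shows "continuous_on {0..1 - \<tau>} (\<lambda>\<alpha>. tv_dist (iid m (P_inner \<alpha>)) (iid m (Q_inner \<alpha> \<tau>)))"
proof -
  let ?I = "sets (iid m (P_inner 0))"
  have sets: "sets (iid m (P_inner \<alpha>)) = ?I" for \<alpha> by (rule sets_iid_cong) simp
  have eq: "tv_dist (iid m (P_inner \<alpha>)) (iid m (Q_inner \<alpha> \<tau>))
      = (SUP S\<in>?I. measure (iid m (P_inner \<alpha>)) S - measure (iid m (P_inner (\<alpha> + \<tau>))) S)" for \<alpha>
    unfolding tv_dist_def Q_inner_eq_P_inner sets[of \<alpha>] by (rule refl)
  have "?I \<subseteq> Pow (space (iid m (P_inner 0)))" by (rule sets.space_closed)
  moreover have "finite (space (iid m (P_inner 0)))"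
    by (auto simp: iid_def space_PiM intro!: finite_PiE)
  ultimately have fin: "finite ?I" by (simp add: finite_subset)
  show ?thesis unfolding eq
  proof (rule continuous_on_SUP_finite[OF fin])
    fix S assume S: "S \<in> ?I"
    note cont = continuous_on_measure_iid_P_inner[OF S]
    show "continuous_on {0..1 - \<tau>}
        (\<lambda>\<alpha>. measure (iid m (P_inner \<alpha>)) S - measure (iid m (P_inner (\<alpha> + \<tau>))) S)"
      using assms
      by (intro continuous_on_diff continuous_on_subset[OF cont]
          continuous_on_compose2[OF cont, of _ "\<lambda>\<alpha>. \<alpha> + \<tau>"]) (auto intro!: continuous_intros)
  qed auto
qed

theorem theorem3:
  fixes \<tau> :: real and m :: nat
  assumes "0 \<le> \<tau>" and "\<tau> \<le> 1" and "0 < m"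
  shows
    "((\<forall>(P :: 'a measure) Q. feasible \<tau> P Q \<longrightarrow> tv_dist (iid m P) (iid m Q) \<le> 1 - (1 - \<tau>) ^ m) \<and>
      (\<exists>(P :: nat measure) Q. feasible \<tau> P Q \<and> tv_dist (iid m P) (iid m Q) = 1 - (1 - \<tau>) ^ m))
     \<and>
     ((\<forall>(P :: 'a measure) Q. feasible \<tau> P Q \<longrightarrow> L \<tau> m \<le> tv_dist (iid m P) (iid m Q)) \<and>
      (\<exists>(P :: nat measure) Q. feasible \<tau> P Q \<and> tv_dist (iid m P) (iid m Q) = L \<tau> m))
     \<and>
     ((\<forall>\<alpha>\<in>{0..1 - \<tau>}. L \<tau> m \<le> tv_dist (iid m (P_inner \<alpha>)) (iid m (Q_inner \<alpha> \<tau>))) \<and>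
      (\<exists>\<alpha>\<in>{0..1 - \<tau>}. tv_dist (iid m (P_inner \<alpha>)) (iid m (Q_inner \<alpha> \<tau>)) = L \<tau> m))"
proof -
  let ?t = "\<lambda>\<alpha>. tv_dist (iid m (P_inner \<alpha>)) (iid m (Q_inner \<alpha> \<tau>))"
  have "compact {0..1 - \<tau>}" "{0..1 - \<tau>} \<noteq> {}" using assms by auto
  then obtain \<alpha> where \<alpha>: "\<alpha> \<in> {0..1 - \<tau>}" and min: "\<And>\<beta>. \<beta> \<in> {0..1 - \<tau>} \<Longrightarrow> ?t \<alpha> \<le> ?t \<beta>"
    using continuous_attains_inf[OF _ _ continuous_on_tv_dist_iid_inner[OF assms(1)]] by blast
  have L: "L \<tau> m = ?t \<alpha>"
    unfolding L_def using \<alpha> min by (intro cInf_eq_minimum) auto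
  \<comment> \<open>The type \<open>'b\<close> is left general because the bound is used both at
    \<open>'a\<close> and, for the inner pair, at \<open>nat\<close>.\<close>
  have upper: "tv_dist (iid m P) (iid m Q) \<le> 1 - (1 - \<tau>) ^ m" if "feasible \<tau> P Q"
    for P Q :: "'b measure"
    using that tv_dist_iid_le[of P Q m] by (auto simp: feasible_def)
  have lower: "L \<tau> m \<le> tv_dist (iid m P) (iid m Q)" if "feasible \<tau> P Q"
    for P Q :: "'b measure"
    using tv_dist_iid_ge_inner[OF that, of m] min L by (metis order.trans)
  have feas0: "feasible \<tau> (P_inner 0) (Q_inner 0 \<tau>)"
    using assms by (intro feasible_inner) auto
  \<comment> \<open>The pair at parameter 0 meets the upper bound, so it is the witness for the
    maximum; the minimizer \<open>\<alpha>\<close> is the witness for the minimum.\<close>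
  have "?t 0 = 1 - (1 - \<tau>) ^ m"
    using upper[OF feas0] tv_dist_iid_inner_0[of \<tau> m] assms by (intro antisym) auto
  then show ?thesis
    using upper lower feas0 feasible_inner[OF assms(1) \<alpha>] \<alpha> min L by metis
qed

end
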